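(* Let $p_1, p_2, \ldots, p_n$ be the first $n$ prime numbers, let $p_{n+1}$ be the $(n+1)$-st prime, and let $\chi$ be a Dirichlet character. Then $$p_{n+1} = \lim_{s\to\infty} \left| \sum_{j=1}^{2p_n-1} \frac{\chi(j)}{j^{s}} - \prod_{k=1}^{n}\left(1-\frac{\chi(p_k)}{p_k^{s}}\right)^{-1}\right|^{-1/s}.$$
   Context: The primes are listed in increasing order: $p_1=2$, $p_2=3$, $p_3=5$, and so on. A Dirichlet character is a multiplicative function $\chi:\mathbb{Z}\to\mathbb{C}$ (that is, $\chi(ab)=\chi(a)\chi(b)$ for all integers $a,b$) with an associated modulus, a positive integer $q$, such that $\chi(a)=\chi(a+mq)$ for all integers $a,m$, and $\chi(a)=0$ if and only if $\gcd(a,q)>1$. The vertical bars denote the complex absolute value.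
   Formalization: The formal theorem adds the hypothesis χ(p_{n+1}) ≠ 0; without it the claim is false, e.g. for n = 1 and the principal character mod 3 the limit is 4 rather than p_2 = 3. *)

theory Defs
  imports Complex_Main "HOL-Library.Infinite_Set" "HOL-Computational_Algebra.Primes"
begin

definition dirichlet_character :: "nat \<Rightarrow> (int \<Rightarrow> complex) \<Rightarrow> bool" where
  "dirichlet_character q chi \<longleftrightarrow>
     q > 0 \<and>
     (\<forall>a b. chi (a * b) = chi a * chi b) \<and>
     (\<forall>a m. chi a = chi (a + m * int q)) \<and>
     (\<forall>a. chi a = 0 \<longleftrightarrow> gcd a (int q) > 1)"

text \<open>\<^const>\<open>enumerate\<close> counts from 0, whereas the primes are numbered from 1 here;
  the value at index 0 is never used.\<close>

definition nth_prime :: "nat \<Rightarrow> nat" where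
  "nth_prime k = enumerate {p. prime p} (k - 1)"

end

theory Submission
  imports Defs "HOL.Binomial_Plus" "HOL-Library.Discrete_Functions"
    "HOL-Analysis.Infinite_Sum" "HOL-Analysis.Summation_Tests" "HOL-Real_Asymp.Real_Asymp"
begin

text \<open>
  Write \<open>P\<close> for the prime following \<open>p\<^sub>n\<close>. For \<open>s > 1\<close> the Euler product over the first \<open>n\<close>
  primes is the sum of \<open>\<chi>(m) / m\<^sup>s\<close> over all positive \<open>m\<close> whose prime divisors are smaller than \<open>P\<close>
  (\<open>finite_euler_product\<close>). Every positive \<open>m < P\<close> is such a number, so in the difference between the
  truncated sum and the product all terms below \<open>P\<close> cancel. The number \<open>P\<close> itself has the prime
  divisor \<open>P\<close>, hence is missing from the product, but it does occur in the truncated sum because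
  \<open>P \<le> 2 p\<^sub>n - 1\<close>; this is Bertrand's postulate. Consequently the difference is a Dirichlet series
  with coefficients bounded by 1 that starts with the term \<open>\<chi>(P) / P\<^sup>s\<close>.

  Multiplying such a series by \<open>P\<^sup>s\<close> leaves \<open>\<chi>(P)\<close> plus terms of size \<open>(P / m)\<^sup>s\<close> with
  \<open>m \<ge> P + 1\<close>, which vanish in the limit uniformly enough to be summed
  (\<open>dirichlet_series_leading_term\<close>). As \<open>\<chi>(P) \<noteq> 0\<close>, the absolute value of the difference behaves like
  \<open>c / P\<^sup>s\<close> with \<open>c > 0\<close>, and its power with exponent \<open>- 1 / s\<close> tends to \<open>P\<close>
  (\<open>tendsto_powr_neg_inverse\<close>).

  Bertrand's postulate is proved by Erdos's argument: without a prime in \<open>(n, 2n]\<close>, the central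
  binomial coefficient, which is at least \<open>4\<^sup>n / (2n)\<close>, would have too few and too small prime power
  factors as soon as \<open>n \<ge> 512\<close>; smaller \<open>n\<close> are covered by a chain of explicit primes.
\<close>

section \<open>Bertrand's postulate\<close>

lemma prod_primes_dvd:
  fixes m :: nat
  assumes "finite A" "\<And>p. p \<in> A \<Longrightarrow> prime p" "\<And>p. p \<in> A \<Longrightarrow> p dvd m"
  shows "\<Prod>A dvd m"
  using assms
proof (induction A rule: finite_induct)
  case (insert p A)
  have "coprime p (\<Prod>A)"
    using insert by (intro prod_coprime_right) (metis insertCI primes_coprime)
  then show ?case
    using insert by (simp add: divides_mult)
qed simp

text \<open>The two equal middle entries of an odd row of Pascal's triangle together do not exceed the
  row sum \<open>2 * 4\<^sup>m\<close>.\<close>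
lemma odd_central_binomial_le: "(2 * m + 1) choose m \<le> 4 ^ m"
proof -
  have "2 * ((2 * m + 1) choose m) = (\<Sum>k\<in>{m, m + 1}. (2 * m + 1) choose k)"
    using binomial_symmetric[of m "2 * m + 1"] by simp
  also have "\<dots> \<le> (\<Sum>k\<le>2 * m + 1. (2 * m + 1) choose k)"
    by (rule sum_mono2) auto
  also have "\<dots> = 2 * 4 ^ m"
    by (simp only: choose_row_sum) (simp add: power_mult)
  finally show ?thesis by simp
qed

text \<open>Chebyshev's bound. For odd \<open>n = 2m + 1\<close> the primes in \<open>(m + 1, n]\<close> divide
  \<open>n!\<close> but neither \<open>m!\<close> nor \<open>(m + 1)!\<close>, so their product divides a binomial coefficient of size
  at most \<open>4\<^sup>m\<close>; the remaining primes are handled by induction. An even \<open>n > 2\<close> is not prime and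
  adds nothing to the product for \<open>n - 1\<close>.\<close>
lemma prod_primes_le_four_power: "\<Prod>{p. prime p \<and> p \<le> n} \<le> (4::nat) ^ n"
proof (induction n rule: less_induct)
  case (less n)
  consider "n \<le> 1" | "n = 2" | "n > 2" "even n" | m where "n = 2 * m + 1" "m \<ge> 1"
    by (cases "even n") (auto elim!: oddE, linarith+)
  then show ?case
  proof cases
    case 1
    then have none: "{p. prime p \<and> p \<le> n} = {}"
      by (auto dest: prime_gt_1_nat)
    show ?thesis unfolding none by simp
  next
    case 2
    then have two: "{p. prime p \<and> p \<le> n} = {2}"
      by (auto dest: prime_ge_2_nat)
    show ?thesis unfolding two using 2 by simp
  next
    case 3
    then have "\<not> prime n"
      using prime_odd_nat by blast
    then have "{p. prime p \<and> p \<le> n} = {p. prime p \<and> p \<le> n - 1}"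
      by (metis (no_types, lifting) diff_le_self le_antisym le_trans not_less_eq_eq
          Suc_pred' gr_zeroI diff_0_eq_0)
    then have "\<Prod>{p. prime p \<and> p \<le> n} \<le> 4 ^ (n - 1)"
      using less.IH[of "n - 1"] 3 by simp
    also have "\<dots> \<le> 4 ^ n" by (rule power_increasing) auto
    finally show ?thesis .
  next
    case 4
    let ?B = "{p. prime p \<and> m + 1 < p \<and> p \<le> n}"
    have split: "{p. prime p \<and> p \<le> n} = {p. prime p \<and> p \<le> m + 1} \<union> ?B"
      using 4 by auto
    have "\<Prod>?B dvd (n choose m)"
    proof (rule prod_primes_dvd)
      fix p assume p: "p \<in> ?B"
      have "p dvd fact n" using p by (simp add: prime_dvd_fact_iff)
      moreover have "fact n = fact m * fact (m + 1) * (n choose m)"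
        using binomial_fact_lemma[of m n] 4 by simp
      moreover have "\<not> p dvd fact m" "\<not> p dvd fact (m + 1)"
        using p prime_dvd_fact_iff[of p m] prime_dvd_fact_iff[of p "m + 1"] by auto
      ultimately show "p dvd (n choose m)"
        using p by (auto simp: prime_dvd_mult_iff)
    qed auto
    then have "\<Prod>?B \<le> (n choose m)"
      using 4 by (intro dvd_imp_le) auto
    also have "\<dots> \<le> 4 ^ m"
      using odd_central_binomial_le 4 by simp
    finally have B: "\<Prod>?B \<le> 4 ^ m" .
    have "\<Prod>{p. prime p \<and> p \<le> n} = \<Prod>{p. prime p \<and> p \<le> m + 1} * \<Prod>?B"
      unfolding split by (rule prod.union_disjoint) auto
    also have "\<dots> \<le> 4 ^ (m + 1) * 4 ^ m"
      using less.IH[of "m + 1"] B 4 by (intro mult_mono) auto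
    also have "\<dots> = 4 ^ n"
      using 4 by (simp add: mult_2 power_add)
    finally show ?thesis .
  qed
qed

lemma multiplicity_eq_card_dividing_powers:
  fixes p m :: nat
  assumes p: "prime p" and m: "m > 0" "m \<le> N"
  shows "multiplicity p m = card {i \<in> {1..N}. p ^ i dvd m}"
proof -
  have "\<not> is_unit p" using p by auto
  then have iff: "p ^ i dvd m \<longleftrightarrow> i \<le> multiplicity p m" for i
    using m by (intro power_dvd_iff_le_multiplicity) auto
  have "multiplicity p m < 2 ^ multiplicity p m" by simp
  also have "\<dots> \<le> p ^ multiplicity p m"
    using prime_ge_2_nat[OF p] by (rule power_mono) simp
  also have "\<dots> \<le> m" using m multiplicity_dvd by (intro dvd_imp_le) auto
  finally have "{i \<in> {1..N}. p ^ i dvd m} = {1..multiplicity p m}"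
    using m by (auto simp: iff)
  then show ?thesis by simp
qed

text \<open>Legendre's formula. The sum may run up to any \<open>N \<ge> n\<close>, since the terms with \<open>p\<^sup>i > n\<close>
  vanish; this freedom allows the formulas for \<open>n!\<close> and \<open>(2n)!\<close> to be subtracted term by term.\<close>
lemma multiplicity_fact:
  fixes p n :: nat
  assumes p: "prime p" and "n \<le> N"
  shows "multiplicity p (fact n) = (\<Sum>i=1..N. n div p ^ i)"
  using \<open>n \<le> N\<close>
proof (induction n)
  case (Suc n)
  have "multiplicity p (fact (Suc n)) = multiplicity p (Suc n) + multiplicity p (fact n)"
    unfolding fact_Suc of_nat_id using p by (intro prime_elem_multiplicity_mult_distrib) auto
  also have "multiplicity p (Suc n) = (\<Sum>i=1..N. of_bool (p ^ i dvd Suc n))"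
    using multiplicity_eq_card_dividing_powers[OF p _ Suc.prems] by (simp add: Int_def)
  also have "multiplicity p (fact n) = (\<Sum>i=1..N. n div p ^ i)"
    using Suc by simp
  also have "(\<Sum>i=1..N. of_bool (p ^ i dvd Suc n)) + (\<Sum>i=1..N. n div p ^ i)
           = (\<Sum>i=1..N. Suc n div p ^ i)"
    unfolding sum.distrib[symmetric] by (intro sum.cong) (auto simp: div_Suc mod_eq_0_iff_dvd)
  finally show ?case .
qed simp

text \<open>Subtracting Legendre's formula for \<open>n!\<close> twice from the one for \<open>(2n)!\<close> leaves the sum of
  \<open>\<lfloor>2n / p\<^sup>i\<rfloor> - 2 \<lfloor>n / p\<^sup>i\<rfloor>\<close>, each of which is 0 or 1 and is 0 once \<open>p\<^sup>i > 2n\<close>.\<close>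
lemma multiplicity_central_binomial_le:
  fixes p n :: nat
  assumes p: "prime p"
  shows "multiplicity p ((2 * n) choose n)
       \<le> card {i \<in> {1..2 * n}. p ^ i \<le> 2 * n \<and> (2 * n) div p ^ i \<noteq> 2 * (n div p ^ i)}"
    (is "?v \<le> card ?S")
proof -
  have "fact (2 * n) = fact n * fact n * ((2 * n) choose n)"
    using binomial_fact_lemma[of n "2 * n"] by simp
  then have "multiplicity p (fact (2 * n)) = 2 * multiplicity p (fact n) + ?v"
    using p by (simp add: prime_elem_multiplicity_mult_distrib)
  then have "2 * (\<Sum>i=1..2*n. n div p ^ i) + ?v = (\<Sum>i=1..2*n. (2 * n) div p ^ i)"
    using multiplicity_fact[OF p, of n "2 * n"] multiplicity_fact[OF p, of "2 * n" "2 * n"] by simp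
  also have "\<dots> \<le> (\<Sum>i=1..2*n. 2 * (n div p ^ i) + of_bool (i \<in> ?S))"
  proof (rule sum_mono)
    fix i assume i: "i \<in> {1..2*n}"
    have q: "p ^ i > 0" using p prime_gt_0_nat by simp
    have "n < p ^ i * (n div p ^ i + 1)"
      using dividend_less_times_div[OF q, of n] by simp
    then have "2 * n < (2 * (n div p ^ i) + 2) * p ^ i"
      by (simp add: algebra_simps)
    then have "(2 * n) div p ^ i < 2 * (n div p ^ i) + 2"
      by (rule less_mult_imp_div_less)
    then show "(2 * n) div p ^ i \<le> 2 * (n div p ^ i) + of_bool (i \<in> ?S)"
      using i by auto
  qed
  also have "\<dots> = 2 * (\<Sum>i=1..2*n. n div p ^ i) + card ?S"
    by (simp add: sum.distrib sum_distrib_left Int_def)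
  finally show ?thesis by simp
qed

text \<open>If the multiplicity is \<open>v > 0\<close>, at least \<open>v\<close> distinct exponents \<open>i \<ge> 1\<close> satisfy
  \<open>p\<^sup>i \<le> 2n\<close>, and the largest of them is at least \<open>v\<close>.\<close>
lemma prime_power_central_binomial_le:
  fixes p n :: nat
  assumes p: "prime p" and n: "n > 0"
  shows "p ^ multiplicity p ((2 * n) choose n) \<le> 2 * n"
proof (cases "multiplicity p ((2 * n) choose n) = 0")
  case False
  let ?v = "multiplicity p ((2 * n) choose n)"
  let ?S = "{i \<in> {1..2 * n}. p ^ i \<le> 2 * n \<and> (2 * n) div p ^ i \<noteq> 2 * (n div p ^ i)}"
  have "\<not> ?S \<subseteq> {1..<?v}"
  proof
    assume "?S \<subseteq> {1..<?v}"
    then have "card ?S \<le> ?v - 1" using card_mono[of "{1..<?v}" ?S] by simp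
    then show False using multiplicity_central_binomial_le[OF p, of n] False by linarith
  qed
  then obtain i where i: "i \<in> ?S" "i \<ge> ?v" by force
  have "p ^ ?v \<le> p ^ i"
    using i prime_gt_0_nat[OF p] by (intro power_increasing) auto
  with i show ?thesis by auto
qed (use n in simp)

text \<open>For \<open>2n / 3 < p \<le> n\<close> the prime \<open>p\<close> occurs exactly twice in \<open>(2n)!\<close> and once in each of the
  two factors \<open>n!\<close>, so it cancels. The prime 2 has to be excluded because \<open>p\<^sup>2 \<ge> 3p > 2n\<close> is used to
  rule out higher powers.\<close>
lemma multiplicity_central_binomial_eq_0:
  fixes p n :: nat
  assumes p: "prime p" and "p \<ge> 3" "p \<le> n" "2 * n < 3 * p"
  shows "multiplicity p ((2 * n) choose n) = 0"
proof -
  have "{i \<in> {1..2 * n}. p ^ i \<le> 2 * n \<and> (2 * n) div p ^ i \<noteq> 2 * (n div p ^ i)} = {}"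
  proof (intro equals0I, clarify)
    fix i assume i: "i \<in> {1..2*n}" "p ^ i \<le> 2 * n" "(2 * n) div p ^ i \<noteq> 2 * (n div p ^ i)"
    show False
    proof (cases "i = 1")
      case True
      have "n div p = 1" "(2 * n) div p = 2"
        using assms by (auto intro!: div_nat_eqI)
      then show False using i True by simp
    next
      case False
      have "3 * p \<le> p * p" using assms by simp
      also have "p * p = p ^ 2" by (simp add: power2_eq_square)
      also have "\<dots> \<le> p ^ i" using False i assms by (intro power_increasing) auto
      finally show False using i assms by simp
    qed
  qed
  then show ?thesis using multiplicity_central_binomial_le[OF p, of n] by (metis card.empty le_zero_eq)
qed

text \<open>The prime factorization is split at \<open>r\<close>, so that \<open>p\<^sup>2 > 2n\<close> for \<open>p > r\<close>. At most \<open>r - 1\<close>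
  primes are \<open>\<le> r\<close>, and each contributes at most \<open>2n\<close>. A larger prime divides the coefficient only
  once; as it is not in \<open>(n, 2n]\<close> by assumption nor in \<open>(2n / 3, n]\<close> by cancellation, it is at most
  \<open>2n / 3\<close>, and Chebyshev's bound controls the product of all of these.\<close>
lemma central_binomial_le_without_primes_between:
  fixes n r :: nat
  assumes n: "n \<ge> 3" and r: "2 * n < (r + 1) ^ 2" 
    and noprime: "\<And>p. prime p \<Longrightarrow> n < p \<Longrightarrow> p \<le> 2 * n \<Longrightarrow> False"
  shows "(2 * n) choose n \<le> (2 * n) ^ (r - 1) * 4 ^ (2 * n div 3)"
proof -
  let ?C = "(2 * n) choose n"
  let ?f = "\<lambda>p. p ^ multiplicity p ?C"
  let ?P = "prime_factors ?C"
  have C: "?C > 0" by simp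
  have small: "(\<Prod>p\<in>{p\<in>?P. p \<le> r}. ?f p) \<le> (2 * n) ^ (r - 1)"
  proof -
    have "(\<Prod>p\<in>{p\<in>?P. p \<le> r}. ?f p) \<le> (\<Prod>p\<in>{p\<in>?P. p \<le> r}. 2 * n)"
      using n by (intro prod_mono conjI prime_power_central_binomial_le) auto
    also have "\<dots> = (2 * n) ^ card {p\<in>?P. p \<le> r}" by simp
    also have "\<dots> \<le> (2 * n) ^ (r - 1)"
    proof (rule power_increasing)
      have "{p\<in>?P. p \<le> r} \<subseteq> {2..r}"
        using prime_ge_2_nat by fastforce
      then have "card {p\<in>?P. p \<le> r} \<le> card {2..r}" by (intro card_mono) auto
      then show "card {p\<in>?P. p \<le> r} \<le> r - 1" by simp
    qed (use n in simp)
    finally show ?thesis .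
  qed
  have large: "(\<Prod>p\<in>{p\<in>?P. \<not> p \<le> r}. ?f p) \<le> 4 ^ (2 * n div 3)"
  proof -
    have *: "?f p \<le> p \<and> p \<le> 2 * n div 3" if "p \<in> ?P" "\<not> p \<le> r" for p
    proof
      have p: "prime p" and dvd: "p dvd ?C" using that by auto
      have pos: "multiplicity p ?C > 0"
        using that by (simp add: prime_factors_multiplicity)
      have "(r + 1) ^ 2 \<le> p ^ 2" using that by (intro power_mono) auto
      with r have sq: "2 * n < p ^ 2" by linarith
      with prime_power_central_binomial_le[OF p, of n] n
      have "p ^ multiplicity p ?C < p ^ 2" by linarith
      then have "multiplicity p ?C < 2"
        using prime_gt_1_nat[OF p] by (simp add: power_strict_increasing_iff)
      with pos have 1: "multiplicity p ?C = 1" by linarith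
      then show "?f p \<le> p" by simp
      have "p ^ 1 \<le> 2 * n" using prime_power_central_binomial_le[OF p, of n] n 1 by simp
      then have "p \<le> n" using noprime[OF p] by (metis not_le power_one_right)
      have "p \<noteq> 2" using sq n by auto
      then have "p \<ge> 3" using prime_ge_2_nat[OF p] by linarith
      then have "\<not> 2 * n < 3 * p"
        using multiplicity_central_binomial_eq_0[OF p _ \<open>p \<le> n\<close>] pos by auto
      then show "p \<le> 2 * n div 3" by linarith
    qed
    have "(\<Prod>p\<in>{p\<in>?P. \<not> p \<le> r}. ?f p) \<le> (\<Prod>p\<in>{p\<in>?P. \<not> p \<le> r}. p)"
      using * by (intro prod_mono) auto
    also have "\<dots> \<le> \<Prod>{p. prime p \<and> p \<le> 2 * n div 3}"
      using * by (intro dvd_imp_le prod_dvd_prod_subset prod_pos) (auto dest: prime_gt_0_nat)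
    also have "\<dots> \<le> 4 ^ (2 * n div 3)" by (rule prod_primes_le_four_power)
    finally show ?thesis .
  qed
  have "?C = (\<Prod>p\<in>?P. ?f p)" using C by (rule prime_factorization_nat)
  also have "?P = {p\<in>?P. p \<le> r} \<union> {p\<in>?P. \<not> p \<le> r}" by auto
  also have "(\<Prod>p\<in>\<dots>. ?f p) = (\<Prod>p\<in>{p\<in>?P. p \<le> r}. ?f p) * (\<Prod>p\<in>{p\<in>?P. \<not> p \<le> r}. ?f p)"
    by (rule prod.union_disjoint) auto
  also have "\<dots> \<le> (2 * n) ^ (r - 1) * 4 ^ (2 * n div 3)"
    using small large by (rule mult_mono) auto
  finally show ?thesis .
qed

text \<open>The numerical fact behind the threshold 512: it fails for \<open>r = 29\<close>, and
  \<open>32 = \<surd>(2 * 512)\<close>.\<close>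
lemma sixth_power_less_two_power:
  fixes r :: nat
  assumes "r \<ge> 32"
  shows "(r + 1) ^ 6 < 2 ^ r"
  using assms
proof (induction r rule: dec_induct)
  case (step r)
  \<comment> \<open>The sixth power grows by the factor \<open>(1 + 1 / (r + 1))\<^sup>6 \<le> (34 / 33)\<^sup>6 < 2\<close>.\<close>
  have "33 ^ 6 * (Suc r + 1) ^ 6 = (33 * (Suc r + 1)) ^ 6" by (rule power_mult_distrib[symmetric])
  also have "\<dots> \<le> (34 * (r + 1)) ^ 6" using step by (intro power_mono) auto
  also have "\<dots> = 34 ^ 6 * (r + 1) ^ 6" by (rule power_mult_distrib)
  also have "\<dots> \<le> (33 ^ 6 * 2) * (r + 1) ^ 6" by (rule mult_right_mono) simp_all
  finally have "(Suc r + 1) ^ 6 \<le> 2 * (r + 1) ^ 6"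
    unfolding mult.assoc by (subst (asm) mult_le_cancel1) simp
  also have "\<dots> < 2 * 2 ^ r" using step by simp
  finally show ?case by simp
qed simp

text \<open>Combining the lower and upper bounds for the central binomial coefficient gives
  \<open>4\<^sup>n \<le> (2n)\<^sup>r * 4\<^bsup>\<lfloor>2n/3\<rfloor>\<^esup>\<close>; cubing clears the fraction \<open>2n / 3\<close> and yields
  \<open>4\<^sup>n \<le> (2n)\<^bsup>3r\<^esup>\<close>. With \<open>r\<^sup>2 \<le> 2n < (r + 1)\<^sup>2\<close> this becomes an inequality between
  \<open>r\<close>-th powers, namely of \<open>2\<^sup>r\<close> and \<open>(r + 1)\<^sup>6\<close>.\<close>
lemma bertrand_large:
  fixes n :: nat
  assumes n: "n \<ge> 512"
  shows "\<exists>p. prime p \<and> n < p \<and> p \<le> 2 * n"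
proof (rule ccontr)
  assume no: "\<not> ?thesis"
  define r where "r = floor_sqrt (2 * n)"
  have r1: "r ^ 2 \<le> 2 * n" by (simp add: r_def)
  have r2: "2 * n < (r + 1) ^ 2" using Suc_floor_sqrt_power2_gt[of "2 * n"] by (simp add: r_def)
  have r32: "r \<ge> 32" unfolding r_def using n by (intro le_floor_sqrtI) simp
  have "real (4 ^ n) = (4 ^ n / (2 * real n)) * (2 * real n)" using n by simp
  also have "\<dots> \<le> real ((2 * n) choose n) * (2 * real n)"
    using n by (intro mult_right_mono central_binomial_lower_bound) auto
  also have "\<dots> = real (((2 * n) choose n) * (2 * n))" by simp
  finally have "4 ^ n \<le> ((2 * n) choose n) * (2 * n)" by (simp only: of_nat_le_iff)
  also have "\<dots> \<le> (2 * n) ^ (r - 1) * 4 ^ (2 * n div 3) * (2 * n)"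
    using n no r2 by (intro mult_right_mono central_binomial_le_without_primes_between) auto
  also have "\<dots> = (2 * n) ^ r * 4 ^ (2 * n div 3)"
    using r32 by (cases r) (auto simp: mult_ac)
  finally have "(4 ^ n) ^ 3 \<le> ((2 * n) ^ r * 4 ^ (2 * n div 3)) ^ 3"
    by (rule power_mono) simp
  also have "\<dots> = (2 * n) ^ (3 * r) * 4 ^ (3 * (2 * n div 3))"
    by (simp add: power_mult_distrib power_mult[symmetric] mult.commute)
  also have "\<dots> \<le> (2 * n) ^ (3 * r) * 4 ^ (2 * n)"
    by (intro mult_left_mono power_increasing) auto
  finally have "4 ^ n * (4::nat) ^ (2 * n) \<le> (2 * n) ^ (3 * r) * 4 ^ (2 * n)"
    by (simp add: power_mult[symmetric] power_add[symmetric] mult.commute)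
  then have four: "4 ^ n \<le> (2 * n) ^ (3 * r)" by simp
  have "(2 ^ r) ^ r = (2::nat) ^ (r ^ 2)" by (simp add: power_mult power2_eq_square)
  also have "\<dots> \<le> 2 ^ (2 * n)" using r1 by (intro power_increasing) auto
  also have "\<dots> = 4 ^ n" by (simp add: power_mult)
  also note four
  also have "(2 * n) ^ (3 * r) \<le> ((r + 1) ^ 2) ^ (3 * r)"
    using r2 by (intro power_mono) auto
  also have "\<dots> = ((r + 1) ^ 6) ^ r" by (simp only: power_mult[symmetric]) simp
  also have "\<dots> < (2 ^ r) ^ r"
    using sixth_power_less_two_power[OF r32] r32 by (intro power_strict_mono) auto
  finally show False by simp
qed

theorem bertrand:
  fixes n :: nat
  assumes "n > 0"
  shows "\<exists>p. prime p \<and> n < p \<and> p \<le> 2 * n"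
proof (cases "n \<ge> 512")
  case False
  \<comment> \<open>Each prime of the chain is less than twice its predecessor.\<close>
  define p :: nat where "p =
    (if n < 2 then 2 else if n < 3 then 3 else if n < 5 then 5 else if n < 7 then 7
     else if n < 13 then 13 else if n < 23 then 23 else if n < 43 then 43 else if n < 83 then 83
     else if n < 163 then 163 else if n < 317 then 317 else 631)"
  have "prime p" unfolding p_def by auto
  moreover have "n < p" unfolding p_def using False by simp
  moreover have "p \<le> 2 * n" unfolding p_def using assms by simp
  ultimately show ?thesis by blast
qed (rule bertrand_large)

section \<open>The finite Euler product\<close>

definition supported_on :: "nat set \<Rightarrow> nat set" where
  "supported_on S = {m. m > 0 \<and> (\<forall>p. prime p \<longrightarrow> p dvd m \<longrightarrow> p \<in> S)}"

lemma supported_on_empty: "supported_on {} = {1}"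
  unfolding supported_on_def using prime_factor_nat by (auto dest: prime_gt_1_nat)

text \<open>A number supported on \<open>S \<union> {p}\<close> is either free of \<open>p\<close> or \<open>p\<close> times another such number.
  This self-similarity replaces the unique representation as \<open>p\<^sup>k\<close> times a number supported on \<open>S\<close>
  and avoids any multiplication of series.\<close>
lemma supported_on_insert:
  assumes "prime p" "p \<notin> S"
  shows "supported_on (insert p S) = supported_on S \<union> (*) p ` supported_on (insert p S)"
    and "supported_on S \<inter> (*) p ` supported_on (insert p S) = {}"
proof -
  have "m \<in> (*) p ` supported_on (insert p S)"
    if m: "m \<in> supported_on (insert p S)" "m \<notin> supported_on S" for m
  proof -
    from m have "p dvd m" by (auto simp: supported_on_def)
    then obtain k where k: "m = p * k" by auto
    with m have "k \<in> supported_on (insert p S)" by (auto simp: supported_on_def)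
    with k show ?thesis by blast
  qed
  moreover have "p * k \<in> supported_on (insert p S)" if "k \<in> supported_on (insert p S)" for k
    using that assms primes_dvd_imp_eq[of _ p]
    by (auto simp: supported_on_def prime_dvd_mult_iff prime_gt_0_nat)
  moreover have "supported_on S \<subseteq> supported_on (insert p S)"
    by (auto simp: supported_on_def)
  ultimately show "supported_on (insert p S) = supported_on S \<union> (*) p ` supported_on (insert p S)"
    by blast
  show "supported_on S \<inter> (*) p ` supported_on (insert p S) = {}"
    using assms by (auto simp: supported_on_def)
qed

text \<open>Summing \<open>f\<close> over the decomposition of \<open>A = supported_on (S \<union> {p})\<close> gives
  \<open>\<Sum>\<^sub>A f = \<Sum>\<^sub>S f + f p * \<Sum>\<^sub>A f\<close>, where \<open>\<Sum>\<^sub>S\<close> runs over the numbers supported on \<open>S\<close>, and this is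
  solved for \<open>\<Sum>\<^sub>A f\<close>. So each Euler factor is obtained from a linear equation rather than from a
  geometric series.\<close>
theorem finite_euler_product:
  fixes f :: "nat \<Rightarrow> 'a :: {real_normed_field, banach}"
  assumes summable: "f summable_on UNIV"
    and one: "f 1 = 1" and mult: "\<And>a b. f (a * b) = f a * f b"
    and "finite S" "\<And>p. p \<in> S \<Longrightarrow> prime p" "\<And>p. p \<in> S \<Longrightarrow> f p \<noteq> 1"
  shows "(\<Prod>p\<in>S. inverse (1 - f p)) = (\<Sum>\<^sub>\<infinity>m\<in>supported_on S. f m)"
  using assms(4-6)
proof (induction S rule: finite_induct)
  case empty
  then show ?case by (simp add: supported_on_empty one[simplified])
next
  case (insert p S)
  let ?A = "supported_on (insert p S)"
  have "prime p" using insert.prems(1) by simp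
  have sub: "f summable_on A" for A
    using summable by (rule summable_on_subset_banach) simp
  have inj: "inj_on ((*) p) ?A"
    using prime_gt_0_nat[OF \<open>prime p\<close>] by (simp add: inj_on_def)
  note decomp = supported_on_insert[OF \<open>prime p\<close> \<open>p \<notin> S\<close>]
  have "infsum f ((*) p ` ?A) = (\<Sum>\<^sub>\<infinity>m\<in>?A. f p * f m)"
    by (simp add: infsum_reindex[OF inj] o_def mult)
  also have "\<dots> = f p * infsum f ?A"
    by (rule infsum_cmult_right[OF sub])
  finally have multiples: "infsum f ((*) p ` ?A) = f p * infsum f ?A" .
  have "infsum f ?A = infsum f (supported_on S \<union> (*) p ` ?A)"
    by (rule arg_cong[OF decomp(1)])
  also have "\<dots> = infsum f (supported_on S) + f p * infsum f ?A"
    unfolding multiples[symmetric] by (rule infsum_Un_disjoint[OF sub sub decomp(2)])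
  finally have "(1 - f p) * infsum f ?A = infsum f (supported_on S)"
    unfolding left_diff_distrib mult_1 diff_eq_eq .
  then have "inverse (1 - f p) * infsum f (supported_on S) = infsum f ?A"
    using insert.prems(2)[of p] by (metis insertI1 right_minus_eq left_inverse mult.assoc mult_1)
  moreover have "(\<Prod>p\<in>S. inverse (1 - f p)) = infsum f (supported_on S)"
    using insert.IH insert.prems by simp
  ultimately show ?case using insert.hyps by simp
qed

section \<open>Asymptotics of Dirichlet series for large real argument\<close>

lemma dirichlet_series_summable:
  fixes b :: "nat \<Rightarrow> complex"
  assumes "\<And>m. cmod (b m) \<le> 1" and "s > 1"
  shows "(\<lambda>m. b m / of_real (real m powr s)) abs_summable_on UNIV"
proof (rule abs_summable_on_comparison_test')
  have "summable (\<lambda>m. real m powr (- s))"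
    using \<open>s > 1\<close> by (simp add: summable_real_powr_iff)
  then show "(\<lambda>m. real m powr (- s)) summable_on UNIV"
    by (rule summable_nonneg_imp_summable_on) simp
  show "norm (b m / of_real (real m powr s)) \<le> real m powr (- s)" for m
    using divide_right_mono[OF assms(1)[of m], of "real m powr s"]
    by (simp add: norm_divide powr_minus_divide)
qed

text \<open>For \<open>m > P\<close> and \<open>s \<ge> 2\<close> we have \<open>m\<^sup>s \<ge> (P + 1)\<^bsup>s-2\<^esup> * m\<^sup>2\<close>, so the tail of the series is
  at most a constant times \<open>(P + 1)\<^bsup>-s\<^esup>\<close>, which is negligible against \<open>P\<^bsup>-s\<^esup>\<close>.\<close>
lemma dirichlet_series_leading_term:
  fixes b :: "nat \<Rightarrow> complex"
  assumes le1: "\<And>m. cmod (b m) \<le> 1" and zero: "\<And>m. m < P \<Longrightarrow> b m = 0" and "P > 0"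
  shows "((\<lambda>s. of_real (real P powr s) * (\<Sum>\<^sub>\<infinity>m. b m / of_real (real m powr s))) \<longlongrightarrow> b P) at_top"
proof -
  let ?f = "\<lambda>s m. b m / of_real (real m powr s) :: complex"
  define K where "K = (\<Sum>\<^sub>\<infinity>m\<in>{P<..}. real m powr (-2))"
  define E where "E = (\<lambda>s. of_real (real P powr s) * (\<Sum>\<^sub>\<infinity>m\<in>{P<..}. ?f s m))"
  have sq: "(\<lambda>m. real m powr (-2)) summable_on {P<..}"
  proof (rule summable_on_subset_banach)
    show "(\<lambda>m. real m powr (-2)) summable_on UNIV"
      by (rule summable_nonneg_imp_summable_on) (simp_all add: summable_real_powr_iff)
  qed simp
  have split: "of_real (real P powr s) * (\<Sum>\<^sub>\<infinity>m. ?f s m) = b P + E s" if "s \<ge> 2" for s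
  proof -
    have abs: "?f s abs_summable_on UNIV"
      using that by (intro dirichlet_series_summable le1) simp
    have "(\<Sum>\<^sub>\<infinity>m. ?f s m) = (\<Sum>\<^sub>\<infinity>m\<in>{P} \<union> {P<..}. ?f s m)"
      by (rule infsum_cong_neutral) (auto simp: zero)
    also have "\<dots> = ?f s P + (\<Sum>\<^sub>\<infinity>m\<in>{P<..}. ?f s m)"
      using abs by (subst infsum_Un_disjoint)
        (auto intro: abs_summable_summable summable_on_subset_banach)
    finally show ?thesis
      using \<open>P > 0\<close> by (simp add: E_def distrib_left)
  qed
  have bound: "cmod (E s) \<le> (K * real (Suc P) ^ 2) * (real P / real (Suc P)) powr s" if "s \<ge> 2" for s
  proof -
    have abs: "?f s abs_summable_on {P<..}"
      using that by (intro summable_on_subset_banach[OF dirichlet_series_summable] le1) auto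
    have "cmod (\<Sum>\<^sub>\<infinity>m\<in>{P<..}. ?f s m) \<le> (\<Sum>\<^sub>\<infinity>m\<in>{P<..}. cmod (?f s m))"
      by (rule norm_infsum_bound[OF abs])
    also have "\<dots> \<le> (\<Sum>\<^sub>\<infinity>m\<in>{P<..}. real (Suc P) powr (2 - s) * real m powr (-2))"
    proof (rule infsum_mono[OF abs])
      show "(\<lambda>m. real (Suc P) powr (2 - s) * real m powr (-2)) summable_on {P<..}"
        by (rule summable_on_cmult_right[OF sq])
      fix m assume m: "m \<in> {P<..}"
      have "cmod (?f s m) \<le> 1 / real m powr s"
        using le1[of m] by (simp add: norm_divide divide_right_mono)
      also have "\<dots> = real m powr (2 - s) * real m powr (-2)"
        using m by (simp add: powr_minus_divide[of _ s, symmetric] flip: powr_add)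
      also have "\<dots> \<le> real (Suc P) powr (2 - s) * real m powr (-2)"
        using m that by (intro mult_right_mono powr_mono2') auto
      finally show "cmod (?f s m) \<le> real (Suc P) powr (2 - s) * real m powr (-2)" .
    qed
    also have "\<dots> = real (Suc P) powr (2 - s) * K"
      unfolding K_def by (rule infsum_cmult_right[OF sq])
    finally have "cmod (E s) \<le> real P powr s * (real (Suc P) powr (2 - s) * K)"
      unfolding E_def norm_mult by (intro mult_mono) auto
    also have "\<dots> = (K * real (Suc P) ^ 2) * (real P / real (Suc P)) powr s"
      by (simp add: powr_diff powr_divide powr_numeral)
    finally show ?thesis .
  qed
  have "((\<lambda>s. (real P / real (Suc P)) powr s) \<longlongrightarrow> 0) at_top"
    using \<open>P > 0\<close> by real_asymp
  then have "((\<lambda>s. (K * real (Suc P) ^ 2) * (real P / real (Suc P)) powr s) \<longlongrightarrow> 0) at_top"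
    by (rule tendsto_mult_right_zero)
  then have "(E \<longlongrightarrow> 0) at_top"
    by (rule Lim_null_comparison[rotated])
       (use bound in \<open>auto intro: eventually_mono[OF eventually_ge_at_top[of 2]]\<close>)
  then have "((\<lambda>s. b P + E s) \<longlongrightarrow> b P + 0) at_top"
    by (intro tendsto_intros)
  then have "((\<lambda>s. b P + E s) \<longlongrightarrow> b P) at_top" by simp
  moreover have "eventually (\<lambda>s. b P + E s = of_real (real P powr s) * (\<Sum>\<^sub>\<infinity>m. ?f s m)) at_top"
    using eventually_ge_at_top[of "2::real"] by eventually_elim (simp add: split)
  ultimately show ?thesis by (rule Lim_transform_eventually)
qed

text \<open>If \<open>g s\<close> behaves like \<open>c / P\<^sup>s\<close>, then the factor \<open>c\<close> disappears because \<open>- 1 / s\<close> tends to 0,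
  while \<open>P\<close> survives because the exponents \<open>- s\<close> and \<open>- 1 / s\<close> multiply to 1.\<close>
lemma tendsto_powr_neg_inverse:
  fixes g :: "real \<Rightarrow> real"
  assumes lim: "((\<lambda>s. P powr s * g s) \<longlongrightarrow> c) at_top" and "c > 0" "P > 0"
    and nonneg: "\<And>s. g s \<ge> 0"
  shows "((\<lambda>s. g s powr (- 1 / s)) \<longlongrightarrow> P) at_top"
proof -
  have "((\<lambda>s::real. - 1 / s) \<longlongrightarrow> 0) at_top"
    by (rule tendsto_divide_0[OF tendsto_const filterlim_at_top_imp_at_infinity[OF filterlim_ident]])
  then have "((\<lambda>s. (P powr s * g s) powr (- 1 / s) * P) \<longlongrightarrow> c powr 0 * P) at_top"
    using lim \<open>c > 0\<close> by (intro tendsto_intros) auto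
  moreover have "eventually (\<lambda>s. (P powr s * g s) powr (- 1 / s) * P = g s powr (- 1 / s)) at_top"
    using eventually_gt_at_top[of "0::real"]
  proof eventually_elim
    case (elim s)
    have "(P powr s * g s) powr (- 1 / s) = P powr (s * (- 1 / s)) * g s powr (- 1 / s)"
      using nonneg[of s] by (simp add: powr_mult powr_powr)
    also have "s * (- 1 / s) = - 1" using elim by simp
    finally show ?case using \<open>P > 0\<close> by (simp add: powr_minus)
  qed
  ultimately have "((\<lambda>s. g s powr (- 1 / s)) \<longlongrightarrow> c powr 0 * P) at_top"
    by (rule Lim_transform_eventually)
  then show ?thesis using \<open>c > 0\<close> by simp
qed

section \<open>Size of character values\<close>

lemma dirichlet_character_1:
  assumes "dirichlet_character q chi"
  shows "chi 1 = 1"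
proof -
  have "chi 1 \<noteq> 0" using assms by (auto simp: dirichlet_character_def)
  moreover have "chi 1 * chi 1 = chi (1 * 1)" using assms unfolding dirichlet_character_def by metis
  ultimately show ?thesis by simp
qed

text \<open>A character takes only finitely many values by periodicity, whereas a value of modulus
  larger than 1 would have unboundedly large powers, which are again values of the character.\<close>
lemma cmod_dirichlet_character_le_1:
  assumes chi: "dirichlet_character q chi"
  shows "cmod (chi a) \<le> 1"
proof (rule ccontr)
  assume "\<not> ?thesis"
  then have gt: "cmod (chi a) > 1" by simp
  have q: "q > 0" and period: "\<And>a m. chi a = chi (a + m * int q)"
    and mult: "\<And>a b. chi (a * b) = chi a * chi b"
    using chi by (auto simp: dirichlet_character_def)
  define B where "B = Max ((\<lambda>r. cmod (chi r)) ` {0..<int q})"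
  have bounded: "cmod (chi x) \<le> B" for x
  proof -
    have "chi (x mod int q) = chi x"
      using period[of "x mod int q" "x div int q"] by simp
    moreover have "x mod int q \<in> {0..<int q}" using q by simp
    ultimately show ?thesis unfolding B_def by (intro Max_ge) (auto intro: rev_image_eqI)
  qed
  have power: "chi (a ^ k) = chi a ^ k" for k
    by (induction k) (simp_all add: mult dirichlet_character_1[OF chi])
  obtain k where "B < cmod (chi a) ^ k" using real_arch_pow[OF gt] by blast
  with bounded[of "a ^ k"] show False by (simp add: power norm_power)
qed

section \<open>Enumerating the primes\<close>

lemma
  shows prime_nth_prime: "prime (nth_prime k)"
    and bij_betw_nth_prime: "bij_betw nth_prime {1..n} {p. prime p \<and> p < nth_prime (n + 1)}"
    and nth_prime_next_le: "k \<ge> 1 \<Longrightarrow> prime p \<Longrightarrow> nth_prime k < p \<Longrightarrow> nth_prime (k + 1) \<le> p"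
proof -
  have inf: "infinite {p::nat. prime p}" by (rule primes_infinite)
  have prime: "prime (nth_prime k)" for k
    using enumerate_in_set[OF inf] by (simp add: nth_prime_def)
  have less: "nth_prime i < nth_prime j \<longleftrightarrow> i < j" if "i \<ge> 1" "j \<ge> 1" for i j
    using that inf by (auto simp: nth_prime_def)
  have ex: "\<exists>k\<ge>1. nth_prime k = p" if p: "prime p" for p
  proof -
    obtain i where "enumerate {p. prime p} i = p" using enumerate_Ex[OF inf, of p] p by auto
    then show ?thesis by (intro exI[of _ "i + 1"]) (simp add: nth_prime_def)
  qed
  show "prime (nth_prime k)" by (rule prime)
  show "bij_betw nth_prime {1..n} {p. prime p \<and> p < nth_prime (n + 1)}"
  proof (rule bij_betw_imageI)
    show "inj_on nth_prime {1..n}"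
    proof (rule linorder_inj_onI)
      show "nth_prime i \<noteq> nth_prime j" if "i < j" "i \<in> {1..n}" "j \<in> {1..n}" for i j
        using less[of i j] that by auto
    qed auto
    show "nth_prime ` {1..n} = {p. prime p \<and> p < nth_prime (n + 1)}"
    proof (intro equalityI subsetI)
      fix p assume "p \<in> {p. prime p \<and> p < nth_prime (n + 1)}"
      then obtain k where "k \<ge> 1" "nth_prime k = p" "nth_prime k < nth_prime (n + 1)"
        using ex by blast
      then show "p \<in> nth_prime ` {1..n}" using less[of k "n + 1"] by force
    qed (use prime less in auto)
  qed
  show "nth_prime (k + 1) \<le> p" if "k \<ge> 1" "prime p" "nth_prime k < p"
  proof -
    obtain i where i: "i \<ge> 1" "nth_prime i = p" using ex[OF \<open>prime p\<close>] by blast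
    with that less[of k i] have "k + 1 \<le> i" by simp
    with i less[of i "k + 1"] show ?thesis by (simp add: not_less[symmetric])
  qed
qed

text \<open>Bertrand's postulate yields a prime in \<open>(p\<^sub>n, 2 p\<^sub>n]\<close>, and the right end point is composite.\<close>
lemma nth_prime_next_less_double:
  assumes "n \<ge> 1"
  shows "nth_prime (n + 1) < 2 * nth_prime n"
proof -
  obtain p where p: "prime p" "nth_prime n < p" "p \<le> 2 * nth_prime n"
    using bertrand[OF prime_gt_0_nat[OF prime_nth_prime[of n]]] by blast
  have "\<not> prime (2 * nth_prime n)"
    using prime_product[of 2 "nth_prime n"] prime_gt_1_nat[OF prime_nth_prime[of n]] by auto
  then have "p < 2 * nth_prime n" using p by (metis le_neq_implies_less)
  then show ?thesis using nth_prime_next_le[OF assms p(1,2)] by simp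
qed

section \<open>Recovering the next prime\<close>

(* The last hypothesis cannot be omitted: for the principal character modulo 3 and n = 1
   the limit is 4, while the second prime is 3. *)
theorem theorem1:
  fixes n q :: nat and chi :: "int \<Rightarrow> complex"
  assumes "n \<ge> 1"
    and "dirichlet_character q chi"
    and "chi (int (nth_prime (n + 1))) \<noteq> 0"
  shows "((\<lambda>s::real.
            cmod ((\<Sum>j = 1..2 * nth_prime n - 1. chi (int j) / of_real (real j powr s))
              - (\<Prod>k = 1..n. inverse (1 - chi (int (nth_prime k)) / of_real (real (nth_prime k) powr s))))
            powr (- 1 / s))
          \<longlongrightarrow> real (nth_prime (n + 1))) at_top"
proof -
  define P where "P = nth_prime (n + 1)"
  define S where "S = {p. prime p \<and> p < P}"
  define J where "J = {1..2 * nth_prime n - 1}"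
  define f where "f = (\<lambda>s m. chi (int m) / of_real (real m powr s))"
  define D where "D = (\<lambda>s. (\<Sum>j\<in>J. f s j) - (\<Prod>k = 1..n. inverse (1 - f s (nth_prime k))))"
  \<comment> \<open>For \<open>s > 1\<close>, \<open>D s\<close> is the Dirichlet series with these coefficients, each of which is \<open>\<chi>\<close>, \<open>- \<chi>\<close> or 0.\<close>
  define b where "b = (\<lambda>m. chi (int m) * (of_bool (m \<in> J) - of_bool (m \<in> supported_on S)))"
  have P: "prime P" unfolding P_def by (rule prime_nth_prime)
  then have "P > 0" by (rule prime_gt_0_nat)
  have "P \<in> J"
    using nth_prime_next_less_double[OF assms(1)] \<open>P > 0\<close> by (auto simp: J_def P_def)
  have "P \<notin> supported_on S"
    using P by (auto simp: supported_on_def S_def)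
  \<comment> \<open>This is the cancellation of all terms below \<open>P\<close>; for \<open>m = 0\<close> both sides are false.\<close>
  have small: "m \<in> J \<longleftrightarrow> m \<in> supported_on S" if "m < P" for m
    using that \<open>P \<in> J\<close> by (auto simp: J_def supported_on_def S_def dest: dvd_imp_le)
  have le1: "cmod (chi a) \<le> 1" for a
    using assms(2) by (rule cmod_dirichlet_character_le_1)
  have D_eq: "D s = (\<Sum>\<^sub>\<infinity>m. b m / of_real (real m powr s))" if "s > 1" for s
  proof -
    have "f s abs_summable_on UNIV"
      unfolding f_def using that le1 by (intro dirichlet_series_summable) auto
    then have summable: "f s summable_on A" for A
      by (rule summable_on_subset_banach[OF abs_summable_summable]) simp
    have mult: "f s (x * y) = f s x * f s y" for x y
      using assms(2) by (simp add: f_def dirichlet_character_def powr_mult)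
    have ne1: "f s p \<noteq> 1" if "p \<in> S" for p
    proof -
      have "real p powr s > 1"
        using prime_gt_1_nat[of p] that \<open>s > 1\<close> by (simp add: S_def)
      then have "cmod (f s p) < 1"
        using le1[of "int p"] by (simp add: f_def norm_divide divide_less_eq)
      then show ?thesis by auto
    qed
    have indicator: "(\<lambda>m. f s m * of_bool (m \<in> A)) summable_on UNIV" for A
      using summable[of A] by (rule summable_on_cong_neutral[THEN iffD1, rotated -1]) auto
    have masked: "(\<Sum>\<^sub>\<infinity>m\<in>A. f s m) = (\<Sum>\<^sub>\<infinity>m. f s m * of_bool (m \<in> A))" for A
      by (rule infsum_cong_neutral) auto
    have "(\<Prod>k = 1..n. inverse (1 - f s (nth_prime k))) = (\<Prod>p\<in>S. inverse (1 - f s p))"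
      unfolding S_def P_def by (rule prod.reindex_bij_betw[OF bij_betw_nth_prime])
    also have "\<dots> = (\<Sum>\<^sub>\<infinity>m\<in>supported_on S. f s m)"
      using summable mult ne1 dirichlet_character_1[OF assms(2)]
      by (intro finite_euler_product) (auto simp: f_def S_def)
    finally have "D s = (\<Sum>\<^sub>\<infinity>m\<in>J. f s m) - (\<Sum>\<^sub>\<infinity>m\<in>supported_on S. f s m)"
      by (simp add: D_def J_def)
    also have "\<dots>
      = (\<Sum>\<^sub>\<infinity>m. f s m * of_bool (m \<in> J) + - (f s m * of_bool (m \<in> supported_on S)))"
      unfolding masked using indicator by (subst infsum_add) (auto simp: infsum_uminus summable_on_uminus)
    also have "\<dots> = (\<Sum>\<^sub>\<infinity>m. b m / of_real (real m powr s))"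
      by (rule infsum_cong) (simp add: b_def f_def diff_divide_distrib right_diff_distrib)
    finally show ?thesis .
  qed
  have "((\<lambda>s. of_real (real P powr s) * (\<Sum>\<^sub>\<infinity>m. b m / of_real (real m powr s))) \<longlongrightarrow> b P) at_top"
    using le1 small \<open>P > 0\<close> by (intro dirichlet_series_leading_term) (auto simp: b_def)
  moreover have "eventually (\<lambda>s. of_real (real P powr s) * (\<Sum>\<^sub>\<infinity>m. b m / of_real (real m powr s))
      = of_real (real P powr s) * D s) at_top"
    using eventually_gt_at_top[of "1::real"] by eventually_elim (simp add: D_eq)
  ultimately have "((\<lambda>s. of_real (real P powr s) * D s) \<longlongrightarrow> b P) at_top"
    by (rule Lim_transform_eventually)
  from tendsto_norm[OF this] have "((\<lambda>s. real P powr s * cmod (D s)) \<longlongrightarrow> cmod (b P)) at_top"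
    by (simp add: norm_mult)
  then have "((\<lambda>s. cmod (D s) powr (- 1 / s)) \<longlongrightarrow> real P) at_top"
    using assms(3) \<open>P > 0\<close> \<open>P \<in> J\<close> \<open>P \<notin> supported_on S\<close>
    by (intro tendsto_powr_neg_inverse) (auto simp: b_def P_def)
  then show ?thesis by (simp only: D_def f_def J_def P_def)
qed

end
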